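(* Let $T$ be a simple tree with vertex set $\{v_1,v_2,\ldots,v_n\}$, and let $k$ be a nonnegative integer. Let $\mathcal A_{n,k}(T)=\{\sigma\in\mathcal S_n : |\sigma_T|=k\}$ and $N_{n,k}(T)=\sum_{\sigma\in\mathcal A_{n,k}(T)}\mathrm{sgn}(\sigma)$. Then $$N_{n,k}(T)=\begin{cases}0 & \text{if } k \text{ is odd},\\ (-1)^{k/2}\binom{n-1}{k/2} & \text{if } k \text{ is even}.\end{cases}$$ In particular, $N_{n,k}(T)$ is independent of the structure of $T$.
   Context: $\mathcal S_n$ is the set of permutations of $\{1,\dots,n\}$ and $\mathrm{sgn}(\sigma)$ is the sign of $\sigma$ ($+1$ for even, $-1$ for odd permutations). A simple tree is a finite tree in which every edge has weight $1$, so that $d(u,v)$ is the number of edges on the unique path between vertices $u$ and $v$ (with $d(u,u)=0$). The length of $\sigma\in\mathcal S_n$ on $T$ is $|\sigma_T|=\sum_{i=1}^n d(v_i,v_{\sigma(i)})$. Binomial coefficients $\binom{m}{j}$ with $j>m\ge 0$ are $0$. *)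

theory Defs
  imports "Graph_Theory.Graph_Theory" "HOL-Combinatorics.Permutations"
begin

text \<open>
  A finite simple graph is a symmetric loop-free digraph (\<open>pair_graph\<close>), so an undirected edge
  \<open>{u, w}\<close> is the pair of arcs \<open>(u, w)\<close>, \<open>(w, u)\<close>, and \<open>(u, w), (w, u)\<close> is a \<open>cycle\<close> of the
  library. Undirected cycles are therefore the cycles of length at least 3. The library's \<open>tree\<close> is
  not usable here: it forbids directed cycles only, which rules out every symmetric graph with an
  edge. Nonemptiness of the vertex set is part of \<open>connected\<close>.
\<close>

definition simple_tree :: "'a pair_pre_digraph \<Rightarrow> bool" where
  "simple_tree T \<longleftrightarrow> pair_graph T \<and> connected (with_proj T) \<and>
     \<not> (\<exists>p. pre_digraph.cycle (with_proj T) p \<and> 3 \<le> length p)"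

text \<open>
  The number of edges on the unique path from \<open>u\<close> to \<open>w\<close>; the value is meaningful only if there is
  exactly one such path, as is the case for vertices of a tree.
\<close>

definition tree_dist :: "'a pair_pre_digraph \<Rightarrow> 'a \<Rightarrow> 'a \<Rightarrow> nat" where
  "tree_dist T u w = length (THE p. pre_digraph.apath (with_proj T) u p w)"

text \<open>In the following, \<open>v\<close> is an enumeration of the vertices of \<open>T\<close> by \<open>{1..n}\<close>.\<close>

definition perm_length :: "'a pair_pre_digraph \<Rightarrow> (nat \<Rightarrow> 'a) \<Rightarrow> nat \<Rightarrow> (nat \<Rightarrow> nat) \<Rightarrow> nat" where
  "perm_length T v n \<sigma> = (\<Sum>i = 1..n. tree_dist T (v i) (v (\<sigma> i)))"

definition perms_of_length :: "'a pair_pre_digraph \<Rightarrow> (nat \<Rightarrow> 'a) \<Rightarrow> nat \<Rightarrow> nat \<Rightarrow> (nat \<Rightarrow> nat) set" where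
  "perms_of_length T v n k = {\<sigma>. \<sigma> permutes {1..n} \<and> perm_length T v n \<sigma> = k}"

definition signed_count :: "'a pair_pre_digraph \<Rightarrow> (nat \<Rightarrow> 'a) \<Rightarrow> nat \<Rightarrow> nat \<Rightarrow> int" where
  "signed_count T v n k = (\<Sum>\<sigma> \<in> perms_of_length T v n k. sign \<sigma>)"

end

theory Submission
  imports Defs "HOL-Computational_Algebra.Polynomial"
begin

text \<open>
  The generating polynomial of the signed counts is the determinant of the matrix with entries
  \<open>x ^ d(v\<^sub>i, v\<^sub>j)\<close>. Let \<open>a\<close> be a vertex at maximal distance from a root, and \<open>p\<close> its parent. Every
  path from \<open>a\<close> to another vertex starts with the edge to \<open>p\<close>, so row \<open>a\<close> is \<open>x\<close> times row \<open>p\<close> except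
  in column \<open>a\<close>, where subtracting \<open>x\<close> times row \<open>p\<close> leaves \<open>1 - x\<^sup>2\<close>. Removing the vertices one by one
  gives the determinant \<open>(1 - x\<^sup>2) ^ (n - 1)\<close>.
\<close>

section \<open>Determinants over finite index sets\<close>

text \<open>Leibniz's formula, over an arbitrary index set so that deleting a vertex merely shrinks
  \<open>S\<close> and keeps the matrix \<open>M\<close>.\<close>

definition perm_det :: "'a set \<Rightarrow> ('a \<Rightarrow> 'a \<Rightarrow> 'b::comm_ring_1) \<Rightarrow> 'b" where
  "perm_det S M = (\<Sum>\<sigma> | \<sigma> permutes S. of_int (sign \<sigma>) * (\<Prod>i\<in>S. M i (\<sigma> i)))"

text \<open>This is the determinant with row \<open>a\<close> overwritten by row \<open>p\<close>.
  Composing with the transposition of \<open>a\<close> and \<open>p\<close> flips the sign and swaps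
  two factors taken from equal rows, so the sum is its own negative.\<close>

lemma perm_det_duplicate_row:
  fixes M :: "'a \<Rightarrow> 'a \<Rightarrow> 'b::{idom, ring_char_0}"
  assumes "finite S" "a \<notin> S" "p \<in> S"
  shows "(\<Sum>\<sigma> | \<sigma> permutes insert a S. of_int (sign \<sigma>) * (M p (\<sigma> a) * (\<Prod>i\<in>S. M i (\<sigma> i)))) = 0"
    (is "sum ?f ?P = 0")
proof -
  let ?t = "transpose a p"
  have t: "?t permutes insert a S"
    using assms by (intro permutes_swap_id) auto
  have neg: "?f (\<sigma> \<circ> ?t) = - ?f \<sigma>" if "\<sigma> \<in> ?P" for \<sigma>
  proof -
    have "permutation \<sigma>" "permutation ?t"
      using that t assms by (auto simp: permutation_permutes intro!: exI[of _ "insert a S"])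
    moreover have "a \<noteq> p"
      using assms by auto
    ultimately have s: "sign (\<sigma> \<circ> ?t) = - sign \<sigma>"
      by (simp add: sign_compose sign_swap_id)
    have "(\<Prod>i\<in>S - {p}. M i ((\<sigma> \<circ> ?t) i)) = (\<Prod>i\<in>S - {p}. M i (\<sigma> i))"
      using assms by (intro prod.cong) (auto simp: transpose_def)
    then show ?thesis
      unfolding s using assms by (simp add: prod.remove[of S p] mult_ac)
  qed
  have "sum ?f ?P = (\<Sum>\<sigma>\<in>?P. ?f (\<sigma> \<circ> ?t))"
    by (rule sum_permutations_compose_right[OF t])
  also have "\<dots> = - sum ?f ?P"
    by (simp only: sum_negf[symmetric] neg cong: sum.cong)
  finally have "2 * sum ?f ?P = 0"
    by (simp add: eq_neg_iff_add_eq_0)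
  then show ?thesis
    by simp
qed

text \<open>Subtracting \<open>c\<close> times row \<open>p\<close> clears row \<open>a\<close>
  outside column \<open>a\<close>; expanding along row \<open>a\<close> then leaves a single
  minor.\<close>

lemma perm_det_insert:
  fixes M :: "'a \<Rightarrow> 'a \<Rightarrow> 'b::{idom, ring_char_0}"
  assumes "finite S" "a \<notin> S" "p \<in> S" and row: "\<And>j. j \<in> S \<Longrightarrow> M a j = c * M p j"
  shows "perm_det (insert a S) M = (M a a - c * M p a) * perm_det S M"
proof -
  let ?P = "{\<sigma>. \<sigma> permutes insert a S}"
  let ?R = "\<lambda>\<sigma>. \<Prod>i\<in>S. M i (\<sigma> i)"
  let ?e = "M a a - c * M p a"
  have fin: "finite ?P"
    using assms by (simp add: finite_permutations)
  have fix_a: "{\<sigma>\<in>?P. \<sigma> a = a} = {\<sigma>. \<sigma> permutes S}"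
    using \<open>a \<notin> S\<close>
    by (auto intro: permutes_subset permutes_superset[where S = "insert a S"] simp: permutes_not_in)
  \<comment> \<open>Replace \<open>M a (\<sigma> a)\<close> by \<open>c * M p (\<sigma> a)\<close>.
    The error is \<open>?e\<close> if \<open>\<sigma>\<close> fixes \<open>a\<close>, and 0
    otherwise by \<open>row\<close>.\<close>
  have split: "of_int (sign \<sigma>) * (\<Prod>i\<in>insert a S. M i (\<sigma> i)) =
      c * (of_int (sign \<sigma>) * (M p (\<sigma> a) * ?R \<sigma>)) +
      (if \<sigma> a = a then ?e * (of_int (sign \<sigma>) * ?R \<sigma>) else 0)" if "\<sigma> \<in> ?P" for \<sigma>
  proof -
    have "\<sigma> a \<in> insert a S"
      using that permutes_in_image[of \<sigma> "insert a S" a] by simp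
    then show ?thesis
      using assms by (auto simp: algebra_simps)
  qed
  have "perm_det (insert a S) M =
      c * (\<Sum>\<sigma>\<in>?P. of_int (sign \<sigma>) * (M p (\<sigma> a) * ?R \<sigma>)) +
      (\<Sum>\<sigma>\<in>?P. if \<sigma> a = a then ?e * (of_int (sign \<sigma>) * ?R \<sigma>) else 0)"
    unfolding perm_det_def by (simp only: split sum.distrib sum_distrib_left cong: sum.cong)
  also have "(\<Sum>\<sigma>\<in>?P. of_int (sign \<sigma>) * (M p (\<sigma> a) * ?R \<sigma>)) = 0"
    by (rule perm_det_duplicate_row) fact+
  also have "(\<Sum>\<sigma>\<in>?P. if \<sigma> a = a then ?e * (of_int (sign \<sigma>) * ?R \<sigma>) else 0) = ?e * perm_det S M"
    unfolding perm_det_def fix_a[symmetric] sum_distrib_left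
    by (rule sum.inter_filter[OF fin, symmetric])
  finally show ?thesis
    by simp
qed

text \<open>The structure of the tree enters through \<open>parent\<close>. The bound
  \<open>d r j \<le> d r a\<close> is there because the equation fails for descendants of
  \<open>a\<close>, which lie farther from the root. For a farthest \<open>a\<close> the bound
  always holds, so \<open>a\<close> can be removed.\<close>

lemma perm_det_monom_dist:
  fixes d :: "'a \<Rightarrow> 'a \<Rightarrow> nat"
  assumes "finite S" "r \<in> S"
    and sym: "\<And>i j. i \<in> S \<Longrightarrow> j \<in> S \<Longrightarrow> d i j = d j i"
    and refl: "\<And>i. i \<in> S \<Longrightarrow> d i i = 0"
    and parent: "\<And>a. a \<in> S - {r} \<Longrightarrow>
      \<exists>p\<in>S. \<forall>j\<in>S - {a}. d r j \<le> d r a \<longrightarrow> d a j = Suc (d p j)"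
  shows "perm_det S (\<lambda>i j. monom (1::int) (d i j)) = (1 - monom 1 2) ^ (card S - 1)"
  using assms
proof (induction "card S" arbitrary: S rule: less_induct)
  case less
  let ?M = "\<lambda>i j. monom (1::int) (d i j)"
  show ?case
  proof (cases "S = {r}")
    case True
    then show ?thesis
      using less.prems(4) by (simp add: perm_det_def)
  next
    case False
    then have "finite (S - {r})" "S - {r} \<noteq> {}"
      using less.prems(1,2) by auto
    then have "Max (d r ` (S - {r})) \<in> d r ` (S - {r})"
      by (intro Max_in) auto
    then obtain a where a: "a \<in> S - {r}" "d r a = Max (d r ` (S - {r}))"
      by (metis imageE)
    then have max': "d r b \<le> d r a" if "b \<in> S - {r}" for b
      using that \<open>finite (S - {r})\<close> by simp
    have max: "d r b \<le> d r a" if "b \<in> S" for b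
      using max' that less.prems(2,4) by (cases "b = r") auto
    let ?S = "S - {a}"
    \<comment> \<open>The case \<open>j = r\<close> shows that a parent is nearer to the root. Hence
      the farthest vertex \<open>a\<close> is neither its own parent nor that of another vertex, and
      \<open>parent\<close> survives its removal.\<close>
    have closer: "d r p < d r b"
      if "b \<in> S - {r}" "p \<in> S" "\<forall>j\<in>S - {b}. d r j \<le> d r b \<longrightarrow> d b j = Suc (d p j)" for b p
    proof -
      have "d b r = Suc (d p r)"
        using that less.prems(2,4) by auto
      then show ?thesis
        using that less.prems(2,3) by auto
    qed
    have S: "S = insert a ?S"
      using a by auto
    obtain p where p: "p \<in> S" "\<forall>j\<in>S - {a}. d r j \<le> d r a \<longrightarrow> d a j = Suc (d p j)"
      using less.prems(5)[OF a(1)] by blast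
    have pS: "p \<in> ?S"
      using p closer[OF a(1) p] by auto
    \<comment> \<open>The case \<open>j = p\<close>, with \<open>d p p = 0\<close>.\<close>
    have "d a p = 1"
      using p pS max less.prems(4) by auto
    then have "d p a = 1"
      using a pS less.prems(3) by auto
    have "perm_det (insert a ?S) ?M = (?M a a - monom 1 1 * ?M p a) * perm_det ?S ?M"
      using less.prems(1) pS p max by (intro perm_det_insert) (auto simp: mult_monom)
    also have "?M a a - monom 1 1 * ?M p a = 1 - monom 1 2"
      using \<open>d p a = 1\<close> a less.prems(4) by (simp add: mult_monom numeral_2_eq_2)
    also have "perm_det ?S ?M = (1 - monom 1 2) ^ (card ?S - 1)"
    proof (rule less.hyps)
      show "card ?S < card S"
        using a less.prems(1) by (intro psubset_card_mono) auto
      show "\<exists>q\<in>?S. \<forall>j\<in>?S - {b}. d r j \<le> d r b \<longrightarrow> d b j = Suc (d q j)" if b: "b \<in> ?S - {r}" for b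
      proof -
        obtain q where q: "q \<in> S" "\<forall>j\<in>S - {b}. d r j \<le> d r b \<longrightarrow> d b j = Suc (d q j)"
          using less.prems(5)[of b] b by blast
        have "d r q < d r a"
          using closer[OF _ q] max[of b] b by fastforce
        then show ?thesis
          using q by auto
      qed
    qed (use less.prems a in auto)
    \<comment> \<open>\<open>?S\<close> contains \<open>p\<close>, so \<open>card ?S - 1\<close> is
      a genuine predecessor.\<close>
    also have "(1 - monom 1 2) * (1 - monom 1 2) ^ (card ?S - 1) =
        (1 - monom 1 2 :: int poly) ^ (card S - 1)"
    proof -
      have "card ?S > 0"
        using pS less.prems(1) by (auto simp: card_gt_0_iff)
      moreover have "card ?S = card S - 1"
        using a by simp
      ultimately show ?thesis
        by (metis power_eq_if less_numeral_extra(3))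
    qed
    finally show ?thesis
      using S by simp
  qed
qed

lemma coeff_one_minus_square_power:
  "coeff ((1 - monom 1 2 :: int poly) ^ m) k =
     (if odd k then 0 else (- 1) ^ (k div 2) * int (m choose (k div 2)))"
proof -
  have "(1 - monom 1 2 :: int poly) ^ m = (monom (- 1) 2 + 1) ^ m"
    by (simp add: minus_monom[symmetric])
  also have "\<dots> = (\<Sum>i\<le>m. monom (int (m choose i) * (- 1) ^ i) (2 * i))"
    unfolding binomial_ring
    by (intro sum.cong) (auto simp: monom_power of_nat_monom mult_monom)
  finally have "coeff ((1 - monom 1 2 :: int poly) ^ m) k =
      (\<Sum>i\<le>m. if 2 * i = k then int (m choose i) * (- 1) ^ i else 0)"
    by (simp add: coeff_sum)
  \<comment> \<open>The only candidate index is \<open>k div 2\<close>, with odd \<open>k\<close>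
    excluded. If it exceeds \<open>m\<close>, the sum is 0, as is the binomial coefficient.\<close>
  also have "\<dots> = (\<Sum>i\<le>m. if i = k div 2 then if odd k then 0 else int (m choose i) * (- 1) ^ i else 0)"
    by (intro sum.cong) auto
  also have "\<dots> = (if odd k then 0 else (- 1) ^ (k div 2) * int (m choose (k div 2)))"
    by (auto simp: binomial_eq_0)
  finally show ?thesis .
qed

section \<open>Paths in simple trees\<close>

lemma length_rev_path: "length (rev_path p) = length p"
  by (induction p) auto

locale simple_tree_graph = pair_graph G for G :: "'a pair_pre_digraph" +
  assumes simple_tree: "simple_tree G"
begin

lemma apath_exists:
  assumes "u \<in> pverts G" "w \<in> pverts G"
  shows "\<exists>p. apath u p w"
proof -
  \<comment> \<open>\<open>connected\<close> asks for strong connectivity of the symmetric closure;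
    a symmetric graph is its own closure.\<close>
  have "parcs (mk_symmetric (with_proj G)) = parcs G"
    by (auto simp: mk_symmetric_def intro: arcs_symmetric)
  then have "mk_symmetric (with_proj G) = G"
    by (simp add: mk_symmetric_def)
  then have "strongly_connected (with_proj G)"
    using simple_tree by (simp add: simple_tree_def connected_def)
  then show ?thesis
    using assms by (auto simp: strongly_connected_def reachable_apath)
qed

text \<open>Strip common first arcs. Where two paths leave \<open>u\<close> by different arcs, going
  along one tail and back along the other joins the two neighbours without meeting \<open>u\<close>;
  closing up through \<open>u\<close> gives a forbidden cycle.\<close>

lemma apath_unique:
  assumes "apath u p w" "apath u q w"
  shows "p = q"
  using assms
proof (induction p arbitrary: u q)
  case Nil
  then show ?case
    using apath_nonempty_ends[of u q w] by (auto simp: apath_simps)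
next
  case (Cons e p')
  then have "u \<noteq> w"
    using apath_nonempty_ends by blast
  then obtain f q' where q: "q = f # q'"
    using Cons.prems by (cases q) (auto simp: apath_simps)
  obtain x y where e: "e = (u, x)" and f: "f = (u, y)"
    using Cons.prems unfolding q by (cases e, cases f) (auto simp: apath_simps)
  have arcs: "(u, x) \<in> parcs G" "(u, y) \<in> parcs G"
    and paths: "apath x p' w" "apath y q' w"
    and avoid: "u \<notin> set (awalk_verts x p')" "u \<notin> set (awalk_verts y q')"
    using Cons.prems unfolding q e f by (auto simp: apath_simps)
  show ?case
  proof (cases "x = y")
    case True
    then show ?thesis
      using Cons.IH[OF paths(1)] paths(2) q e f by auto
  next
    case False
    have walks: "awalk x p' w" "awalk w (rev_path q') y" "awalk y q' w"
      using paths by (auto simp: apath_def)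
    let ?r = "p' @ rev_path q'"
    let ?s = "awalk_to_apath ?r"
    have r: "awalk x ?r y"
      using walks(1,2) by (rule awalk_appendI)
    have s: "apath x ?s y"
      using r by (rule apath_awalk_to_apath)
    then have ws: "awalk x ?s y"
      by (rule awalkI_apath)
    have "u \<notin> set (awalk_verts x ?r)"
      using avoid set_awalk_verts_append[OF walks(1,2)] awalk_verts_rev_path[OF walks(3)] by auto
    \<comment> \<open>Shortening a walk to a path adds no vertices.\<close>
    then have u: "u \<notin> set (awalk_verts x ?s)"
      using awalk_to_apath_subset[OF r] set_awalk_verts[OF r] set_awalk_verts[OF ws] by auto
    let ?c = "(u, x) # ?s @ [(y, u)]"
    \<comment> \<open>\<open>x \<noteq> y\<close> forces an arc in \<open>?s\<close>, so the cycle
      is not one of the permitted ones formed by an edge and its reverse.\<close>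
    have "?s \<noteq> []"
      using False ws by (auto simp: awalk_simps)
    then have len: "3 \<le> length ?c"
      by (cases ?s) auto
    have sc: "awalk x (?s @ [(y, u)]) u"
      using ws arcs by (intro awalk_appendI[OF ws]) (auto simp: awalk_simps intro: arcs_symmetric in_arcsD1)
    then have "awalk u ?c u"
      using arcs sc by (simp only: awalk_Cons_iff fst_conv snd_conv)
    moreover have "awalk_verts u ?c = u # awalk_verts x ?s @ [u]"
      using awalk_verts_append[OF sc] by simp
    ultimately have "cycle ?c"
      using s u unfolding cycle_def by (intro exI[of _ u]) (auto simp: apath_def)
    then show ?thesis
      using simple_tree len unfolding simple_tree_def by blast
  qed
qed

lemma tree_dist_apath: "apath u p w \<Longrightarrow> tree_dist G u w = length p"
  unfolding tree_dist_def using apath_unique by (metis the_equality)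

lemma tree_dist_self: "u \<in> pverts G \<Longrightarrow> tree_dist G u u = 0"
  using tree_dist_apath[of u "[]" u] by (simp add: apath_simps)

lemma tree_dist_commute:
  assumes "u \<in> pverts G" "w \<in> pverts G"
  shows "tree_dist G u w = tree_dist G w u"
proof -
  obtain p where p: "apath u p w"
    using apath_exists[OF assms] by blast
  then have "tree_dist G w u = length (rev_path p)"
    by (intro tree_dist_apath) simp
  then show ?thesis
    using p by (simp add: tree_dist_apath length_rev_path)
qed

lemma apath_decomp:
  assumes "apath u p w" "x \<in> set (awalk_verts u p)"
  obtains q r where "p = q @ r" "apath u q x" "apath x r w"
proof -
  obtain q r where "p = q @ r" "awalk u q x" "awalk x r w"
    using awalk_decomp assms by (metis apath_def)
  moreover from this have "apath u q x" "apath x r w"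
    using assms(1) apath_append_iff[of u q r w] by auto
  ultimately show thesis
    using that by blast
qed

text \<open>Take for \<open>p\<close> the last vertex before \<open>a\<close> on the path from
  \<open>r\<close>. If the path from \<open>a\<close> to \<open>j\<close> avoided \<open>p\<close>,
  appending it to the path from \<open>r\<close> to \<open>a\<close> would give a path, putting
  \<open>j\<close> farther from \<open>r\<close> than \<open>a\<close>. So it passes through
  \<open>p\<close>, and by uniqueness it starts with the arc to \<open>p\<close>.\<close>

lemma tree_dist_parent:
  assumes "r \<in> pverts G" "a \<in> pverts G" "a \<noteq> r"
  shows "\<exists>p\<in>pverts G. \<forall>j\<in>pverts G - {a}.
    tree_dist G r j \<le> tree_dist G r a \<longrightarrow> tree_dist G a j = Suc (tree_dist G p j)"
proof -
  obtain P where P: "apath r P a"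
    using apath_exists assms by blast
  then have "P \<noteq> []"
    using assms by (auto simp: apath_simps)
  then obtain P0 e where Pe: "P = P0 @ [e]"
    by (metis append_butlast_last_id)
  obtain p where e: "e = (p, a)"
    using P unfolding Pe by (cases e) (auto simp: apath_append_iff apath_simps)
  have pa: "(p, a) \<in> parcs G" "p \<noteq> a"
    using P unfolding Pe e by (auto simp: apath_append_iff apath_simps)
  then have ap: "apath a [(a, p)] p"
    by (auto simp: apath_simps intro: arcs_symmetric in_arcsD1)
  have "tree_dist G a j = Suc (tree_dist G p j)"
    if j: "j \<in> pverts G" "j \<noteq> a" "tree_dist G r j \<le> tree_dist G r a" for j
  proof -
    obtain q where q: "apath a q j"
      using apath_exists assms j by blast
    have "p \<in> set (awalk_verts a q)"
    proof (rule ccontr)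
      assume avoid: "p \<notin> set (awalk_verts a q)"
      \<comment> \<open>The two paths can meet only at \<open>a\<close>: from another common vertex
        \<open>x\<close>, the rest of \<open>P\<close> ends with the arc \<open>(p, a)\<close>, and
        by uniqueness its reverse begins \<open>q\<close>, bringing \<open>p\<close> into
        \<open>q\<close>.\<close>
      have disj: False if x: "x \<in> set (awalk_verts r P)" "x \<in> set (tl (awalk_verts a q))" for x
      proof -
        have "awalk_verts a q = a # tl (awalk_verts a q)"
          using q by (cases q) (auto simp: apath_simps)
        then have "x \<noteq> a"
          using q x(2) unfolding apath_def by (metis distinct.simps(2))
        obtain A B where AB: "P = A @ B" "apath x B a"
          using apath_decomp[OF P x(1)] by blast
        have "B \<noteq> []"
          using AB \<open>x \<noteq> a\<close> by (auto simp: apath_simps)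
        then have "(p, a) \<in> set B"
          using AB(1) Pe e by (metis last_appendR last_in_set last_snoc)
        then have pB: "p \<in> set (awalk_verts x B)"
          using awalk_verts_arc1 by fastforce
        have "x \<in> set (awalk_verts a q)"
          using x(2) by (meson list.set_sel(2) awalk_verts_non_Nil)
        then obtain C D where CD: "q = C @ D" "apath a C x" "apath x D j"
          using apath_decomp[OF q] by blast
        have "C = rev_path B"
          using CD(2) AB(2) by (intro apath_unique) auto
        then have "p \<in> set (awalk_verts a C)"
          using pB AB(2) awalk_verts_rev_path[of x B a] by (simp add: apath_def)
        then show False
          using avoid CD set_awalk_verts_append[of a C x D j] by (auto simp: apath_def)
      qed
      have "awlast r P = a"
        using P by (auto simp: apath_def)
      then have "apath r (P @ q) j"
        using P q disj by (auto simp: apath_append_iff)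
      then have "tree_dist G r j = tree_dist G r a + length q"
        using P by (simp add: tree_dist_apath)
      moreover have "q \<noteq> []"
        using q j by (auto simp: apath_simps)
      ultimately show False
        using j by simp
    qed
    then obtain A B where AB: "q = A @ B" "apath a A p" "apath p B j"
      using apath_decomp[OF q] by blast
    then have "A = [(a, p)]"
      using ap apath_unique by blast
    then show ?thesis
      using AB q by (simp add: tree_dist_apath)
  qed
  then show ?thesis
    using pa by (intro bexI[of _ p]) (auto dest: in_arcsD1)
qed

end

section \<open>Signed counts as polynomial coefficients\<close>

lemma signed_count_eq_coeff:
  "signed_count T v n k =
     coeff (perm_det {1..n} (\<lambda>i j. monom (1::int) (tree_dist T (v i) (v j)))) k"
proof -
  \<comment> \<open>Multiplying monomials adds exponents, so each permutation contributes its sign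
    at the exponent \<open>perm_length T v n \<sigma>\<close>.\<close>
  have prod: "(\<Prod>i\<in>A. monom (1::int) (f i)) = monom 1 (\<Sum>i\<in>A. f i)" for A and f :: "nat \<Rightarrow> nat"
    by (induction A rule: infinite_finite_induct) (auto simp: mult_monom)
  have "coeff (perm_det {1..n} (\<lambda>i j. monom (1::int) (tree_dist T (v i) (v j)))) k =
      (\<Sum>\<sigma> | \<sigma> permutes {1..n}. if perm_length T v n \<sigma> = k then sign \<sigma> else 0)"
    unfolding perm_det_def coeff_sum prod perm_length_def
    by (intro sum.cong) (auto simp: of_int_poly)
  also have "\<dots> = signed_count T v n k"
    unfolding signed_count_def perms_of_length_def
    by (subst sum.inter_filter[symmetric]) (auto simp: finite_permutations)
  finally show ?thesis ..
qed

lemma signed_count_simple_tree: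
  assumes T: "simple_tree T" and v: "bij_betw v {1..n} (pverts T)"
  shows "signed_count T v n k =
     (if odd k then 0 else (- 1) ^ (k div 2) * int ((n - 1) choose (k div 2)))"
proof -
  interpret pair_graph T
    using T by (simp add: simple_tree_def)
  interpret simple_tree_graph T
    by unfold_locales (rule T)
  have "pverts T \<noteq> {}"
    using T by (auto simp: simple_tree_def connected_def strongly_connected_def mk_symmetric_def)
  \<comment> \<open>A tree has a vertex, so \<open>n \<ge> 1\<close> and index 1 can serve as the
    root.\<close>
  then have n: "1 \<in> {1..n}"
    using v by (cases n) (auto simp: bij_betw_def)
  have inj: "inj_on v {1..n}"
    using v by (rule bij_betw_imp_inj_on)
  have vT: "v i \<in> pverts T" if "i \<in> {1..n}" for i
    using v that by (rule bij_betwE[THEN bspec])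
  have "perm_det {1..n} (\<lambda>i j. monom (1::int) (tree_dist T (v i) (v j))) =
      (1 - monom 1 2) ^ (card {1..n} - 1)"
  proof (rule perm_det_monom_dist)
    fix a assume a: "a \<in> {1..n} - {1}"
    then have "v a \<noteq> v 1"
      using inj_on_eq_iff[OF inj, of a 1] n by blast
    then obtain p where p: "p \<in> pverts T"
      "\<forall>j\<in>pverts T - {v a}. tree_dist T (v 1) j \<le> tree_dist T (v 1) (v a) \<longrightarrow>
         tree_dist T (v a) j = Suc (tree_dist T p j)"
      using tree_dist_parent[of "v 1" "v a"] vT a n by blast
    obtain p' where p': "p' \<in> {1..n}" "p = v p'"
      using p(1) bij_betw_imp_surj_on[OF v] by blast
    have "v j \<in> pverts T - {v a}" if "j \<in> {1..n} - {a}" for j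
      using that a vT[of j] inj_on_eq_iff[OF inj, of j a] by blast
    then show "\<exists>p\<in>{1..n}. \<forall>j\<in>{1..n} - {a}.
        tree_dist T (v 1) (v j) \<le> tree_dist T (v 1) (v a) \<longrightarrow>
        tree_dist T (v a) (v j) = Suc (tree_dist T (v p) (v j))"
      using p(2) p' by blast
  qed (use n vT tree_dist_self tree_dist_commute in auto)
  then show ?thesis
    by (simp add: signed_count_eq_coeff coeff_one_minus_square_power)
qed

theorem theorem3p5:
  fixes T :: "'a pair_pre_digraph" and v :: "nat \<Rightarrow> 'a" and n k :: nat
  assumes "simple_tree T"
    and "bij_betw v {1..n} (pverts T)"
  shows "signed_count T v n k =
           (if odd k then 0 else (- 1) ^ (k div 2) * int ((n - 1) choose (k div 2))) \<and>
         (\<forall>(T' :: 'b pair_pre_digraph) (v' :: nat \<Rightarrow> 'b).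
           simple_tree T' \<longrightarrow> bij_betw v' {1..n} (pverts T') \<longrightarrow>
           signed_count T' v' n k = signed_count T v n k)"
  \<comment> \<open>The formula depends only on \<open>n\<close> and \<open>k\<close> and holds for
    every vertex type, so it applies to both trees.\<close>
  using assms by (simp add: signed_count_simple_tree)

end
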